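(* Let $\mathcal{J}(y)=\int_a^b L\left(x,y(x),y^{(\alpha)}_a(x)\right)\,d^\alpha_a x$. If $\mathcal{J}$ is invariant, up to the gauge term $\Lambda$, under a family of transformations $$\overline x=x+\epsilon\,\tau(x,y(x)),\qquad \overline y=y+\epsilon\,\xi(x,y(x)),$$ then $$\frac{\partial L}{\partial x}\tau+\frac{\partial L}{\partial y}\xi+\frac{\partial L}{\partial y^{(\alpha)}_a}\left[\xi^{(\alpha)}_a-y^{(\alpha)}_a\left((\alpha-1)\frac{\tau}{x-a}+\frac{\tau^{(\alpha)}_a}{(x-a)^{1-\alpha}}\right)\right]+L\,\frac{\tau^{(\alpha)}_a}{(x-a)^{1-\alpha}}=\frac{d^\alpha_a\Lambda}{dx^\alpha_a}.$$
   Context: Let $a<b$ be real and $0<\alpha\le1$. The left conformable fractional derivative of order $\alpha$ starting from $a$ of $f:[a,b]\to\mathbb{R}$ is $$f^{(\alpha)}_a(x)=\frac{d^\alpha_a}{dx^\alpha_a}f(x)=\lim_{\epsilon\to0}\frac{f(x+\epsilon(x-a)^{1-\alpha})-f(x)}{\epsilon}$$ (endpoint values being defined as one-sided limits), and $\int_a^b f(x)\,d^\alpha_a x=\int_a^b f(x)(x-a)^{\alpha-1}\,dx$. The Lagrangian $L=L(x,y,v):[a,b]\times\mathbb{R}^2\to\mathbb{R}$ is of class $C^1$ in each of its arguments, and $\mathcal{J}$ is defined on continuous $y:[a,b]\to\mathbb{R}$ for which $y^{(\alpha)}_a$ exists on $[a,b]$. The partial derivatives $\frac{\partial L}{\partial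 x},\frac{\partial L}{\partial y},\frac{\partial L}{\partial y^{(\alpha)}_a}$ are with respect to the first, second, third arguments, evaluated at $(x,y(x),y^{(\alpha)}_a(x))$. Transformations: $\epsilon$ is a real parameter, and the generators $\tau,\xi$ are such that $\overline x\ge a$ and $\tau^{(\alpha)}_a$, $\xi^{(\alpha)}_a$ exist, where $\tau^{(\alpha)}_a$, $\xi^{(\alpha)}_a$ and $\frac{d^\alpha_a\Lambda}{dx^\alpha_a}$ denote the conformable derivatives of $x\mapsto\tau(x,y(x))$, $x\mapsto\xi(x,y(x))$, $x\mapsto\Lambda(x,y(x))$. Invariance: $\mathcal{J}$ is invariant under the family of transformations up to the gauge term $\Lambda$ if a function $\Lambda=\Lambda(x,y)$ exists such that for any function $y$ and any real $x\in[a,b]$, $$L\left(\overline x,\overline y,\frac{d^\alpha_a\overline y}{d\overline x^\alpha_a}\right)\frac{d^\alpha_a\overline x}{d^\alpha_a x}=L(x,y,y^{(\alpha)}_a)+\epsilon\frac{d^\alpha_a\Lambda}{dx^\alpha_a}(x,y)+o(\epsilon)$$ for all $\epsilon$ in some neighborhood of zero, where $$\frac{d^\alpha_a\overline x}{d^\alpha_a x}:=\frac{d^\alpha_a\overline x/dx^\alpha_a}{d^\alpha_a x/dx^\alpha_a}=1+\epsilon\frac{\tau^{(\alpha)}_a}{(x-a)^{1-\alpha}},$$ and $\frac{d^\alpha_a\overline y}{d\overline x^\alpha_a}$ is the conformable derivative of $\overline y$ with respect to $\overline x$, i.e. (by the conformable chain rule) $$\frac{d^\alpha_a\overline y}{d\overline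 x^\alpha_a}=\frac{y^{(\alpha)}_a+\epsilon\,\xi^{(\alpha)}_a}{(x+\epsilon\tau-a)^{\alpha-1}\left[(x-a)^{1-\alpha}+\epsilon\,\tau^{(\alpha)}_a\right]}.$$ *)

theory Defs
  imports "HOL-Analysis.Analysis" "HOL-Library.Landau_Symbols"
begin

text \<open>
  Functions on \<open>[a, b]\<close> are represented by total functions; every notion below depends only on
  their values on \<open>[a, b]\<close>.
\<close>

definition has_conf_deriv :: "real \<Rightarrow> real \<Rightarrow> (real \<Rightarrow> real) \<Rightarrow> real \<Rightarrow> real \<Rightarrow> bool" where
  "has_conf_deriv a \<alpha> f D x \<longleftrightarrow>
     ((\<lambda>\<epsilon>. (f (x + \<epsilon> * (x - a) powr (1 - \<alpha>)) - f x) / \<epsilon>) \<longlongrightarrow> D) (at 0)"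

definition conf_deriv_inner :: "real \<Rightarrow> real \<Rightarrow> (real \<Rightarrow> real) \<Rightarrow> real \<Rightarrow> real" where
  "conf_deriv_inner a \<alpha> f x =
     Lim (at 0) (\<lambda>\<epsilon>. (f (x + \<epsilon> * (x - a) powr (1 - \<alpha>)) - f x) / \<epsilon>)"

text \<open>
  At \<open>a\<close> the defining quotient degenerates when \<open>\<alpha> < 1\<close>; the values at both end points are the
  one-sided limits of the derivative on the open interval.
\<close>

definition conf_deriv :: "real \<Rightarrow> real \<Rightarrow> real \<Rightarrow> (real \<Rightarrow> real) \<Rightarrow> real \<Rightarrow> real" where
  "conf_deriv a b \<alpha> f x =
     (if x = a then Lim (at_right a) (conf_deriv_inner a \<alpha> f)
      else if x = b then Lim (at_left b) (conf_deriv_inner a \<alpha> f)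
      else conf_deriv_inner a \<alpha> f x)"

definition conf_differentiable :: "real \<Rightarrow> real \<Rightarrow> real \<Rightarrow> (real \<Rightarrow> real) \<Rightarrow> bool" where
  "conf_differentiable a b \<alpha> f \<longleftrightarrow>
     (\<forall>x\<in>{a<..<b}. \<exists>D. has_conf_deriv a \<alpha> f D x) \<and>
     (\<exists>D. (conf_deriv_inner a \<alpha> f \<longlongrightarrow> D) (at_right a)) \<and>
     (\<exists>D. (conf_deriv_inner a \<alpha> f \<longlongrightarrow> D) (at_left b))"

text \<open>
  The derivatives \<open>d\<^sub>a\<^sup>\<alpha> u / d\<^sub>a\<^sup>\<alpha> v\<close> (a quotient of conformable derivatives) and
  \<open>d\<^sub>a\<^sup>\<alpha> u / d v\<^sub>a\<^sup>\<alpha>\<close> (the conformable derivative of \<open>u\<close> with respect to the variable \<open>v\<close>).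
  The latter is given by the conformable chain rule, so that \<open>v\<close> need not be invertible.
\<close>

definition conf_deriv_quot ::
    "real \<Rightarrow> real \<Rightarrow> real \<Rightarrow> (real \<Rightarrow> real) \<Rightarrow> (real \<Rightarrow> real) \<Rightarrow> real \<Rightarrow> real" where
  "conf_deriv_quot a b \<alpha> u v x = conf_deriv a b \<alpha> u x / conf_deriv a b \<alpha> v x"

definition conf_deriv_wrt ::
    "real \<Rightarrow> real \<Rightarrow> real \<Rightarrow> (real \<Rightarrow> real) \<Rightarrow> (real \<Rightarrow> real) \<Rightarrow> real \<Rightarrow> real" where
  "conf_deriv_wrt a b \<alpha> u v x =
     conf_deriv a b \<alpha> u x / ((v x - a) powr (\<alpha> - 1) * conf_deriv a b \<alpha> v x)"

definition conf_integral :: "real \<Rightarrow> real \<Rightarrow> real \<Rightarrow> (real \<Rightarrow> real) \<Rightarrow> real" where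
  "conf_integral a b \<alpha> f = integral {a..b} (\<lambda>x. f x * (x - a) powr (\<alpha> - 1))"

text \<open>The partial derivatives of \<open>L\<close>; the first one is one-sided at \<open>x = a\<close> and \<open>x = b\<close>.\<close>

definition partial_x ::
    "real \<Rightarrow> real \<Rightarrow> (real \<Rightarrow> real \<Rightarrow> real \<Rightarrow> real) \<Rightarrow> real \<Rightarrow> real \<Rightarrow> real \<Rightarrow> real" where
  "partial_x a b L x y v = vector_derivative (\<lambda>s. L s y v) (at x within {a..b})"

definition partial_y :: "(real \<Rightarrow> real \<Rightarrow> real \<Rightarrow> real) \<Rightarrow> real \<Rightarrow> real \<Rightarrow> real \<Rightarrow> real" where
  "partial_y L x y v = deriv (\<lambda>s. L x s v) y"

definition partial_v :: "(real \<Rightarrow> real \<Rightarrow> real \<Rightarrow> real) \<Rightarrow> real \<Rightarrow> real \<Rightarrow> real \<Rightarrow> real" where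
  "partial_v L x y v = deriv (\<lambda>s. L x y s) v"

definition C1_Lagrangian :: "real \<Rightarrow> real \<Rightarrow> (real \<Rightarrow> real \<Rightarrow> real \<Rightarrow> real) \<Rightarrow> bool" where
  "C1_Lagrangian a b L \<longleftrightarrow>
     (\<forall>x\<in>{a..b}. \<forall>y v.
        (\<lambda>s. L s y v) differentiable (at x within {a..b}) \<and>
        (\<lambda>s. L x s v) differentiable (at y) \<and>
        (\<lambda>s. L x y s) differentiable (at v)) \<and>
     continuous_on ({a..b} \<times> UNIV \<times> UNIV) (\<lambda>(x, y, v). partial_x a b L x y v) \<and>
     continuous_on ({a..b} \<times> UNIV \<times> UNIV) (\<lambda>(x, y, v). partial_y L x y v) \<and>
     continuous_on ({a..b} \<times> UNIV \<times> UNIV) (\<lambda>(x, y, v). partial_v L x y v)"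

definition admissible :: "real \<Rightarrow> real \<Rightarrow> real \<Rightarrow> (real \<Rightarrow> real) \<Rightarrow> bool" where
  "admissible a b \<alpha> y \<longleftrightarrow> continuous_on {a..b} y \<and> conf_differentiable a b \<alpha> y"

definition action ::
    "real \<Rightarrow> real \<Rightarrow> real \<Rightarrow> (real \<Rightarrow> real \<Rightarrow> real \<Rightarrow> real) \<Rightarrow> (real \<Rightarrow> real) \<Rightarrow> real" where
  "action a b \<alpha> L y = conf_integral a b \<alpha> (\<lambda>x. L x (y x) (conf_deriv a b \<alpha> y x))"

definition admissible_generators ::
    "real \<Rightarrow> real \<Rightarrow> real \<Rightarrow> (real \<Rightarrow> real \<Rightarrow> real) \<Rightarrow> (real \<Rightarrow> real \<Rightarrow> real) \<Rightarrow> bool" where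
  "admissible_generators a b \<alpha> \<tau> \<xi> \<longleftrightarrow>
     (\<forall>y. admissible a b \<alpha> y \<longrightarrow>
        (\<forall>x\<in>{a..b}. \<forall>\<^sub>F \<epsilon> in at 0. x + \<epsilon> * \<tau> x (y x) \<ge> a) \<and>
        conf_differentiable a b \<alpha> (\<lambda>x. \<tau> x (y x)) \<and>
        conf_differentiable a b \<alpha> (\<lambda>x. \<xi> x (y x)))"

text \<open>
  Invariance of \<^const>\<open>action\<close> up to the gauge term \<open>\<Lambda>\<close>.  It is by definition a pointwise condition
  on the integrand \<open>L\<close>; the integral itself does not enter.  The point \<open>x = a\<close> is left out:
  the condition divides by \<open>(x - a) powr (1 - \<alpha>)\<close> and by \<open>(x + \<epsilon> * \<tau> - a) powr (\<alpha> - 1)\<close>,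
  which is meaningless there.  As \<open>L\<close> lives on \<open>[a, b] \<times> \<real>\<^sup>2\<close>, only those \<open>\<epsilon>\<close> are considered for which
  the transformed point lies in \<open>[a, b]\<close>: for \<open>a < x < b\<close> that is a neighbourhood of \<open>0\<close>, and for
  \<open>x = b\<close> it contains at least a one-sided one.
\<close>

definition invariant_up_to ::
    "real \<Rightarrow> real \<Rightarrow> real \<Rightarrow> (real \<Rightarrow> real \<Rightarrow> real \<Rightarrow> real) \<Rightarrow>
     (real \<Rightarrow> real \<Rightarrow> real) \<Rightarrow> (real \<Rightarrow> real \<Rightarrow> real) \<Rightarrow> (real \<Rightarrow> real \<Rightarrow> real) \<Rightarrow> bool" where
  "invariant_up_to a b \<alpha> L \<tau> \<xi> \<Lambda> \<longleftrightarrow>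
     (\<forall>y. admissible a b \<alpha> y \<longrightarrow>
        conf_differentiable a b \<alpha> (\<lambda>x. \<Lambda> x (y x)) \<and>
        (\<forall>x\<in>{a<..b}.
           (\<lambda>\<epsilon>. let X = (\<lambda>t. t + \<epsilon> * \<tau> t (y t)); Y = (\<lambda>t. y t + \<epsilon> * \<xi> t (y t)) in
                 L (X x) (Y x) (conf_deriv_wrt a b \<alpha> Y X x) * conf_deriv_quot a b \<alpha> X (\<lambda>t. t) x
                 - (L x (y x) (conf_deriv a b \<alpha> y x)
                    + \<epsilon> * conf_deriv a b \<alpha> (\<lambda>t. \<Lambda> t (y t)) x))
           \<in> o[at 0 within {\<epsilon>. x + \<epsilon> * \<tau> x (y x) \<in> {a..b}}](\<lambda>\<epsilon>. \<epsilon>)))"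

text \<open>
  In the invariance condition the two derivatives of the transformed quantities are the
  familiar explicit expressions in \<open>\<epsilon>\<close>.
\<close>

lemma conf_deriv_inner_eqI: "has_conf_deriv a \<alpha> f D x \<Longrightarrow> conf_deriv_inner a \<alpha> f x = D"
  unfolding has_conf_deriv_def conf_deriv_inner_def by (rule tendsto_Lim) simp_all

lemma has_conf_deriv_ident: "has_conf_deriv a \<alpha> (\<lambda>t. t) ((x - a) powr (1 - \<alpha>)) x"
proof -
  have "\<forall>\<^sub>F \<epsilon>::real in at 0.
      (x - a) powr (1 - \<alpha>) = (x + \<epsilon> * (x - a) powr (1 - \<alpha>) - x) / \<epsilon>"
    by (simp add: eventually_at_filter)
  then show ?thesis
    unfolding has_conf_deriv_def by (rule Lim_transform_eventually[OF tendsto_const])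
qed

lemma has_conf_deriv_add_mult:
  assumes "has_conf_deriv a \<alpha> f D x" "has_conf_deriv a \<alpha> g E x"
  shows "has_conf_deriv a \<alpha> (\<lambda>t. f t + c * g t) (D + c * E) x"
proof -
  have "((\<lambda>\<epsilon>. (f (x + \<epsilon> * (x - a) powr (1 - \<alpha>)) - f x) / \<epsilon>
            + c * ((g (x + \<epsilon> * (x - a) powr (1 - \<alpha>)) - g x) / \<epsilon>)) \<longlongrightarrow> D + c * E) (at 0)"
    using assms unfolding has_conf_deriv_def by (intro tendsto_intros)
  then show ?thesis
    unfolding has_conf_deriv_def
    by (rule Lim_transform_eventually) (simp add: add_divide_distrib diff_divide_distrib right_diff_distrib)
qed

lemma conf_differentiableD:
  assumes "conf_differentiable a b \<alpha> f"
  shows "t \<in> {a<..<b} \<Longrightarrow> \<exists>D. has_conf_deriv a \<alpha> f D t"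
    and "\<exists>D. (conf_deriv_inner a \<alpha> f \<longlongrightarrow> D) (at_left b)"
  using assms by (simp_all add: conf_differentiable_def)

lemma conf_differentiable_ident:
  assumes "a < b" "\<alpha> \<le> 1"
  shows "conf_differentiable a b \<alpha> (\<lambda>t. t)"
proof -
  have inner: "conf_deriv_inner a \<alpha> (\<lambda>t. t) = (\<lambda>x. (x - a) powr (1 - \<alpha>))"
    by (rule ext) (rule conf_deriv_inner_eqI[OF has_conf_deriv_ident])
  have "\<exists>D. ((\<lambda>x. (x - a) powr (1 - \<alpha>)) \<longlongrightarrow> D) (at_right a)"
  proof (cases "\<alpha> = 1")
    case True
    have "\<forall>\<^sub>F x in at_right a. 1 = (x - a) powr (1 - \<alpha>)"
      using eventually_at_right_less[of a] by eventually_elim (simp add: True)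
    then have "((\<lambda>x. (x - a) powr (1 - \<alpha>)) \<longlongrightarrow> 1) (at_right a)"
      by (rule Lim_transform_eventually[OF tendsto_const])
    then show ?thesis by (rule exI)
  next
    case False
    have "((\<lambda>x. (x - a) powr (1 - \<alpha>)) \<longlongrightarrow> (a - a) powr (1 - \<alpha>)) (at_right a)"
    proof (rule tendsto_powr2)
      show "\<forall>\<^sub>F x in at_right a. 0 \<le> x - a"
        using eventually_at_right_less[of a] by eventually_elim simp
      show "((\<lambda>x. x - a) \<longlongrightarrow> a - a) (at_right a)"
        by (intro tendsto_intros)
    qed (use assms False in auto)
    then show ?thesis by blast
  qed
  moreover have "((\<lambda>x. (x - a) powr (1 - \<alpha>)) \<longlongrightarrow> (b - a) powr (1 - \<alpha>)) (at_left b)"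
    using assms by (intro tendsto_intros) auto
  ultimately show ?thesis
    unfolding conf_differentiable_def inner
    by (metis has_conf_deriv_ident)
qed

lemma conf_deriv_ident:
  assumes "a < b" "x \<in> {a<..b}"
  shows "conf_deriv a b \<alpha> (\<lambda>t. t) x = (x - a) powr (1 - \<alpha>)"
proof -
  have inner: "conf_deriv_inner a \<alpha> (\<lambda>t. t) = (\<lambda>x. (x - a) powr (1 - \<alpha>))"
    by (rule ext) (rule conf_deriv_inner_eqI[OF has_conf_deriv_ident])
  have "((\<lambda>x. (x - a) powr (1 - \<alpha>)) \<longlongrightarrow> (b - a) powr (1 - \<alpha>)) (at_left b)"
    using assms by (intro tendsto_intros) auto
  then have "Lim (at_left b) (\<lambda>x. (x - a) powr (1 - \<alpha>)) = (b - a) powr (1 - \<alpha>)"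
    by (intro tendsto_Lim) simp_all
  then show ?thesis
    using assms by (auto simp: conf_deriv_def inner)
qed

lemma conf_deriv_add_mult:
  assumes "a < b" "x \<in> {a<..b}" "conf_differentiable a b \<alpha> f" "conf_differentiable a b \<alpha> g"
  shows "conf_deriv a b \<alpha> (\<lambda>t. f t + c * g t) x = conf_deriv a b \<alpha> f x + c * conf_deriv a b \<alpha> g x"
proof -
  have inner: "conf_deriv_inner a \<alpha> (\<lambda>t. f t + c * g t) t
      = conf_deriv_inner a \<alpha> f t + c * conf_deriv_inner a \<alpha> g t" if t: "t \<in> {a<..<b}" for t
  proof -
    obtain D where "has_conf_deriv a \<alpha> f D t"
      using conf_differentiableD(1)[OF assms(3) t] ..
    moreover obtain E where "has_conf_deriv a \<alpha> g E t"
      using conf_differentiableD(1)[OF assms(4) t] ..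
    ultimately show ?thesis
      using has_conf_deriv_add_mult[of a \<alpha> f D t g E c] by (simp add: conf_deriv_inner_eqI)
  qed
  show ?thesis
  proof (cases "x = b")
    case True
    obtain D where D: "(conf_deriv_inner a \<alpha> f \<longlongrightarrow> D) (at_left b)"
      using conf_differentiableD(2)[OF assms(3)] ..
    obtain E where E: "(conf_deriv_inner a \<alpha> g \<longlongrightarrow> E) (at_left b)"
      using conf_differentiableD(2)[OF assms(4)] ..
    have "\<forall>\<^sub>F t in at_left b. t \<in> {a<..<b}"
      by (rule eventually_at_leftI[OF _ \<open>a < b\<close>])
    then have "\<forall>\<^sub>F t in at_left b. conf_deriv_inner a \<alpha> f t + c * conf_deriv_inner a \<alpha> g t
        = conf_deriv_inner a \<alpha> (\<lambda>t. f t + c * g t) t"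
      by eventually_elim (simp add: inner)
    moreover have "((\<lambda>t. conf_deriv_inner a \<alpha> f t + c * conf_deriv_inner a \<alpha> g t)
        \<longlongrightarrow> D + c * E) (at_left b)"
      using D E by (intro tendsto_intros)
    ultimately have "((\<lambda>t. conf_deriv_inner a \<alpha> (\<lambda>t. f t + c * g t) t) \<longlongrightarrow> D + c * E) (at_left b)"
      by (rule Lim_transform_eventually[rotated])
    then have "Lim (at_left b) (conf_deriv_inner a \<alpha> (\<lambda>t. f t + c * g t)) = D + c * E"
      by (intro tendsto_Lim) simp_all
    moreover have "Lim (at_left b) (conf_deriv_inner a \<alpha> f) = D"
      using D by (intro tendsto_Lim) simp_all
    moreover have "Lim (at_left b) (conf_deriv_inner a \<alpha> g) = E"
      using E by (intro tendsto_Lim) simp_all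
    ultimately show ?thesis
      using True \<open>a < b\<close> by (simp add: conf_deriv_def)
  next
    case False
    then show ?thesis
      using assms(1,2) by (simp add: conf_deriv_def inner)
  qed
qed

lemma conf_deriv_quot_transformed:
  assumes "a < b" "\<alpha> \<le> 1" "x \<in> {a<..b}" "conf_differentiable a b \<alpha> (\<lambda>t. \<tau> t (y t))"
  shows "conf_deriv_quot a b \<alpha> (\<lambda>t. t + \<epsilon> * \<tau> t (y t)) (\<lambda>t. t) x
    = 1 + \<epsilon> * (conf_deriv a b \<alpha> (\<lambda>t. \<tau> t (y t)) x / (x - a) powr (1 - \<alpha>))"
  using assms
  by (simp add: conf_deriv_quot_def conf_deriv_add_mult conf_differentiable_ident conf_deriv_ident
      add_divide_distrib)

lemma conf_deriv_wrt_transformed: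
  assumes "a < b" "\<alpha> \<le> 1" "x \<in> {a<..b}" "conf_differentiable a b \<alpha> y"
    "conf_differentiable a b \<alpha> (\<lambda>t. \<tau> t (y t))" "conf_differentiable a b \<alpha> (\<lambda>t. \<xi> t (y t))"
  shows "conf_deriv_wrt a b \<alpha> (\<lambda>t. y t + \<epsilon> * \<xi> t (y t)) (\<lambda>t. t + \<epsilon> * \<tau> t (y t)) x
    = (conf_deriv a b \<alpha> y x + \<epsilon> * conf_deriv a b \<alpha> (\<lambda>t. \<xi> t (y t)) x)
      / ((x + \<epsilon> * \<tau> x (y x) - a) powr (\<alpha> - 1)
         * ((x - a) powr (1 - \<alpha>) + \<epsilon> * conf_deriv a b \<alpha> (\<lambda>t. \<tau> t (y t)) x))"
  using assms
  by (simp add: conf_deriv_wrt_def conf_deriv_add_mult conf_differentiable_ident conf_deriv_ident)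

end

theory Submission imports Defs begin

text \<open>
  Since the partial derivatives of \<open>L\<close> are continuous, \<open>L\<close> has a total derivative, one-sided in its
  first argument. By the chain rule the transformed integrand is therefore differentiable in \<open>\<epsilon>\<close>
  at \<open>0\<close>, and its derivative is the left-hand side of the claimed identity. The invariance condition
  says that \<open>d\<^sub>a\<^sup>\<alpha>\<Lambda> / dx\<^sub>a\<^sup>\<alpha>\<close> is a derivative of the same function of \<open>\<epsilon>\<close>, and derivatives are unique,
  because the admissible parameters \<open>\<epsilon>\<close> form a nondegenerate interval containing \<open>0\<close>.
\<close>

text \<open>Variables are joined one at a time by \<open>has_derivative_partialsI\<close>, which
  combines a derivative in the first variable at the point with a continuous partial derivative in
  the second. First \<open>x\<close> and \<open>y\<close> are joined with \<open>v\<close> frozen,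
  then the pair \<open>(x, y)\<close> is joined with \<open>v\<close>; the nesting
  \<open>((x, y), v)\<close> records this order.\<close>

lemma C1_Lagrangian_has_derivative:
  assumes L: "C1_Lagrangian a b L" and x: "x \<in> {a..b}"
  shows "((\<lambda>((x, y), v). L x y v) has_derivative
           (\<lambda>((dx, dy), dv). partial_x a b L x y v * dx + partial_y L x y v * dy
              + partial_v L x y v * dv))
         (at ((x, y), v) within ({a..b} \<times> UNIV) \<times> UNIV)"
proof -
  have Dx: "((\<lambda>s. L s y v) has_derivative (*) (partial_x a b L x y v)) (at x within {a..b})"
  proof -
    have "((\<lambda>s. L s y v) has_vector_derivative partial_x a b L x y v) (at x within {a..b})"
      using L x unfolding C1_Lagrangian_def partial_x_def
      by (simp add: vector_derivative_works)
    then show ?thesis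
      by (simp add: has_vector_derivative_def mult_commute_abs)
  qed
  have Dy: "((\<lambda>s. L p s w) has_derivative (*) (partial_y L p q w)) (at q)"
    if "p \<in> {a..b}" for p q w
    using L that unfolding C1_Lagrangian_def partial_y_def
    by (simp add: DERIV_deriv_iff_real_differentiable flip: has_field_derivative_def)
  have Dv: "((\<lambda>s. L p q s) has_derivative (*) (partial_v L p q w)) (at w)"
    if "p \<in> {a..b}" for p q w
    using L that unfolding C1_Lagrangian_def partial_v_def
    by (simp add: DERIV_deriv_iff_real_differentiable flip: has_field_derivative_def)
  have "continuous_on ({a..b} \<times> UNIV)
      ((\<lambda>(x, y, v). partial_y L x y v) \<circ> (\<lambda>z. (fst z, snd z, v)))"
    using L unfolding C1_Lagrangian_def
    by (intro continuous_on_compose continuous_intros) (auto elim: continuous_on_subset)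
  \<comment> \<open>The joining rule asks for continuity of the partial derivative as a bounded
    linear map; \<open>blinfun_mult_right\<close> turns the number into multiplication by
    it.\<close>
  then have cy: "continuous_on ({a..b} \<times> UNIV)
      (\<lambda>(p, q). blinfun_mult_right (partial_y L p q v))"
    by (auto simp: case_prod_beta comp_def
        intro!: bounded_linear.continuous_on[OF bounded_linear_blinfun_mult_right])
  have "continuous_on (({a..b} \<times> UNIV) \<times> UNIV)
      ((\<lambda>(x, y, v). partial_v L x y v) \<circ> (\<lambda>z. (fst (fst z), snd (fst z), snd z)))"
    using L unfolding C1_Lagrangian_def
    by (intro continuous_on_compose continuous_intros) (auto elim!: continuous_on_subset)
  then have cv: "continuous_on (({a..b} \<times> UNIV) \<times> UNIV)
      (\<lambda>(z, w). blinfun_mult_right (partial_v L (fst z) (snd z) w))"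
    by (auto simp: case_prod_beta comp_def
        intro!: bounded_linear.continuous_on[OF bounded_linear_blinfun_mult_right])
  have xy: "((\<lambda>(p, q). L p q v) has_derivative
      (\<lambda>(dx, dy). partial_x a b L x y v * dx + blinfun_mult_right (partial_y L x y v) dy))
      (at (x, y) within {a..b} \<times> UNIV)"
    using x cy
    by (intro has_derivative_partialsI[where f = "\<lambda>p q. L p q v", OF Dx])
      (auto intro!: Dy simp: continuous_on_eq_continuous_within)
  have "((\<lambda>(z, w). L (fst z) (snd z) w) has_derivative
      (\<lambda>(dz, dv). (\<lambda>(dx, dy). partial_x a b L x y v * dx
           + blinfun_mult_right (partial_y L x y v) dy) dz
         + blinfun_mult_right (partial_v L (fst (x, y)) (snd (x, y)) v) dv))
      (at ((x, y), v) within ({a..b} \<times> UNIV) \<times> UNIV)"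
  proof (rule has_derivative_partialsI)
    show "((\<lambda>z. L (fst z) (snd z) v) has_derivative
        (\<lambda>(dx, dy). partial_x a b L x y v * dx + blinfun_mult_right (partial_y L x y v) dy))
        (at (x, y) within {a..b} \<times> UNIV)"
      using xy by (simp add: case_prod_unfold)
    show "continuous (at ((x, y), v) within ({a..b} \<times> UNIV) \<times> UNIV)
        (\<lambda>(z, w). blinfun_mult_right (partial_v L (fst z) (snd z) w))"
      using cv x by (auto simp: continuous_on_eq_continuous_within)
  qed (auto intro!: Dv)
  then show ?thesis
    by (simp add: case_prod_unfold)
qed

text \<open>Here \<open>c\<close> stands for \<open>x - a\<close>, \<open>d\<close> and
  \<open>e\<close> for the conformable derivatives of \<open>y\<close> and \<xi>, \<open>t\<close>
  for the value of \<tau> and \<open>s\<close> for its conformable derivative. The two powers of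
  \<open>c\<close> cancel, so the denominator \<open>g\<close> is 1 at 0 and the quotient rule
  collapses to \<open>e\<close> minus \<open>d\<close> times the derivative of \<open>g\<close> at
  0.\<close>

lemma transformed_velocity_has_derivative:
  fixes c d e s t \<alpha> :: real
  assumes c: "c > 0"
  shows "((\<lambda>\<epsilon>. (d + \<epsilon> * e) / ((c + \<epsilon> * t) powr (\<alpha> - 1) * (c powr (1 - \<alpha>) + \<epsilon> * s)))
    has_real_derivative e - d * ((\<alpha> - 1) * (t / c) + s / c powr (1 - \<alpha>))) (at 0)"
proof -
  have one: "c powr (\<alpha> - 1) * c powr (1 - \<alpha>) = 1"
    using c by (simp flip: powr_add)
  have inv: "c powr (\<alpha> - 1) = 1 / c powr (1 - \<alpha>)"
    using c one by (simp add: field_simps)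
  define g where "g \<epsilon> = (c + \<epsilon> * t) powr (\<alpha> - 1) * (c powr (1 - \<alpha>) + \<epsilon> * s)" for \<epsilon>
  have g0: "g 0 = 1"
    by (simp add: g_def one)
  have "((\<lambda>\<epsilon>. (c + \<epsilon> * t) powr (\<alpha> - 1)) has_real_derivative
      c powr (\<alpha> - 1) * ((\<alpha> - 1) * (t / c))) (at 0)"
    using c by (intro DERIV_cong[OF DERIV_powr[OF _ _ DERIV_const]])
      (auto intro!: derivative_eq_intros simp: field_simps)
  moreover have "((\<lambda>\<epsilon>. c powr (1 - \<alpha>) + \<epsilon> * s) has_real_derivative s) (at 0)"
    by (auto intro!: derivative_eq_intros)
  ultimately have "(g has_real_derivative
      c powr (\<alpha> - 1) * ((\<alpha> - 1) * (t / c)) * (c powr (1 - \<alpha>) + 0 * s)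
      + s * (c + 0 * t) powr (\<alpha> - 1)) (at 0)"
    unfolding g_def by (rule DERIV_mult)
  moreover have "c powr (\<alpha> - 1) * ((\<alpha> - 1) * (t / c)) * (c powr (1 - \<alpha>) + 0 * s)
      + s * (c + 0 * t) powr (\<alpha> - 1) = (\<alpha> - 1) * (t / c) + s / c powr (1 - \<alpha>)"
    using c by (simp add: inv)
  ultimately have "(g has_real_derivative (\<alpha> - 1) * (t / c) + s / c powr (1 - \<alpha>)) (at 0)"
    by simp
  then have "((\<lambda>\<epsilon>. (d + \<epsilon> * e) / g \<epsilon>) has_real_derivative
      e - d * ((\<alpha> - 1) * (t / c) + s / c powr (1 - \<alpha>))) (at 0)"
    using g0 by (auto intro!: derivative_eq_intros)
  then show ?thesis
    by (simp add: g_def)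
qed

text \<open>The parameter set is the preimage of an interval under an affine map, hence convex. A
  connected set with more than one point has no isolated point, so 0 is a limit point. This also
  covers \<open>x = b\<close>, where the set may lie on one side of 0 only.\<close>

lemma at_within_shift_preimage_neq_bot:
  fixes a b x t :: real
  assumes "a < b" "x \<in> {a..b}"
  shows "at 0 within {\<epsilon>. x + \<epsilon> * t \<in> {a..b}} \<noteq> bot"
proof -
  let ?S = "{\<epsilon>. x + \<epsilon> * t \<in> {a..b}}"
  have "convex ?S"
  proof (rule convexI)
    fix p q u v :: real
    assume "p \<in> ?S" "q \<in> ?S" "0 \<le> u" "0 \<le> v" and uv: "u + v = 1"
    then have "u *\<^sub>R (x + p * t) + v *\<^sub>R (x + q * t) \<in> {a..b}"
      by (intro convexD[OF convex_real_interval(5)]) auto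
    moreover have "u *\<^sub>R (x + p * t) + v *\<^sub>R (x + q * t) = (u + v) * x + (u *\<^sub>R p + v *\<^sub>R q) * t"
      by (simp add: algebra_simps)
    ultimately show "u *\<^sub>R p + v *\<^sub>R q \<in> ?S"
      by (simp add: uv)
  qed
  moreover have "0 \<in> ?S"
    using assms by simp
  moreover have "?S \<noteq> {0}"
  proof (cases "t = 0")
    case True
    with assms have "1 \<in> ?S" by simp
    then show ?thesis by force
  next
    case False
    \<comment> \<open>Any point \<open>z\<close> of the interval other than \<open>x\<close> is
      reached at the nonzero parameter \<open>(z - x) / t\<close>; one of the endpoints serves as
      \<open>z\<close>.\<close>
    have "\<exists>z\<in>{a..b}. z \<noteq> x"
      using assms by (intro bexI[of _ "if x = a then b else a"]) auto
    then obtain z where z: "z \<in> {a..b}" "z \<noteq> x" ..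
    with False have "(z - x) / t \<in> ?S" "(z - x) / t \<noteq> 0" by auto
    then show ?thesis by blast
  qed
  ultimately have "0 islimpt ?S"
    using connected_imp_perfect[OF convex_connected] by (metis singletonD)
  then show ?thesis
    by (simp add: trivial_limit_within)
qed

theorem theorem22:
  fixes a b \<alpha> x :: real
    and L :: "real \<Rightarrow> real \<Rightarrow> real \<Rightarrow> real"
    and \<tau> \<xi> \<Lambda> :: "real \<Rightarrow> real \<Rightarrow> real"
    and y :: "real \<Rightarrow> real"
  assumes "a < b" and "0 < \<alpha>" and "\<alpha> \<le> 1"
    and "C1_Lagrangian a b L"
    and "admissible_generators a b \<alpha> \<tau> \<xi>"
    and "invariant_up_to a b \<alpha> L \<tau> \<xi> \<Lambda>"
    and "admissible a b \<alpha> y"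
    and "x \<in> {a<..b}"
  shows "let Dy = conf_deriv a b \<alpha> y x;
             D\<tau> = conf_deriv a b \<alpha> (\<lambda>t. \<tau> t (y t)) x;
             D\<xi> = conf_deriv a b \<alpha> (\<lambda>t. \<xi> t (y t)) x;
             D\<Lambda> = conf_deriv a b \<alpha> (\<lambda>t. \<Lambda> t (y t)) x
         in partial_x a b L x (y x) Dy * \<tau> x (y x)
            + partial_y L x (y x) Dy * \<xi> x (y x)
            + partial_v L x (y x) Dy
              * (D\<xi> - Dy * ((\<alpha> - 1) * (\<tau> x (y x) / (x - a)) + D\<tau> / (x - a) powr (1 - \<alpha>)))
            + L x (y x) Dy * (D\<tau> / (x - a) powr (1 - \<alpha>))
            = D\<Lambda>"
proof -
  define Dy where "Dy = conf_deriv a b \<alpha> y x"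
  define T where "T = conf_deriv a b \<alpha> (\<lambda>t. \<tau> t (y t)) x"
  define X where "X = conf_deriv a b \<alpha> (\<lambda>t. \<xi> t (y t)) x"
  define G where "G = conf_deriv a b \<alpha> (\<lambda>t. \<Lambda> t (y t)) x"
  define p where "p = (x - a) powr (1 - \<alpha>)"
  define S where "S = {\<epsilon>. x + \<epsilon> * \<tau> x (y x) \<in> {a..b}}"
  \<comment> \<open>\<open>V\<close> is the transformed velocity, with its base written as
    \<open>x - a\<close> plus the shift to fit the velocity lemma; \<open>F\<close> below is the
    transformed integrand including the factor from the change of variable.\<close>
  define V where "V \<epsilon> = (Dy + \<epsilon> * X) / ((x - a + \<epsilon> * \<tau> x (y x)) powr (\<alpha> - 1) * (p + \<epsilon> * T))" for \<epsilon>
  define V' where "V' = X - Dy * ((\<alpha> - 1) * (\<tau> x (y x) / (x - a)) + T / p)"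
  define F where "F \<epsilon> = L (x + \<epsilon> * \<tau> x (y x)) (y x + \<epsilon> * \<xi> x (y x)) (V \<epsilon>) * (1 + \<epsilon> * (T / p))" for \<epsilon>
  have x: "x > a" "x \<in> {a..b}"
    using assms(8) by auto
  have cd: "conf_differentiable a b \<alpha> y"
    "conf_differentiable a b \<alpha> (\<lambda>x. \<tau> x (y x))" "conf_differentiable a b \<alpha> (\<lambda>x. \<xi> x (y x))"
    using assms(5,7) by (auto simp: admissible_generators_def admissible_def)
  have V0: "V 0 = Dy"
    using x by (simp add: V_def p_def flip: powr_add)

  have "(\<lambda>\<epsilon>. F \<epsilon> - (L x (y x) Dy + \<epsilon> * G)) \<in> o[at 0 within S](\<lambda>\<epsilon>. \<epsilon>)"
  proof -
    have "F \<epsilon> = (let X = (\<lambda>t. t + \<epsilon> * \<tau> t (y t)); Y = (\<lambda>t. y t + \<epsilon> * \<xi> t (y t)) in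
        L (X x) (Y x) (conf_deriv_wrt a b \<alpha> Y X x) * conf_deriv_quot a b \<alpha> X (\<lambda>t. t) x)" for \<epsilon>
      using conf_deriv_quot_transformed[where \<tau>=\<tau> and y=y, OF assms(1,3,8) cd(2)]
        conf_deriv_wrt_transformed[where \<tau>=\<tau> and \<xi>=\<xi>, OF assms(1,3,8) cd]
      by (simp add: F_def V_def Dy_def T_def X_def p_def Let_def algebra_simps)
    then show ?thesis
      using assms(6-8) by (simp add: invariant_up_to_def S_def Dy_def G_def Let_def)
  qed
  \<comment> \<open>Dividing the remainder by \<epsilon> gives a null function. Adding
    \<open>G\<close> back leaves the difference quotient of \<open>F\<close>, because
    \<open>F 0\<close> is the untransformed integrand by \<open>V0\<close>.\<close>
  then have "((\<lambda>\<epsilon>. (F \<epsilon> - (L x (y x) Dy + \<epsilon> * G)) / \<epsilon> + G) \<longlongrightarrow> 0 + G) (at 0 within S)"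
    by (intro tendsto_intros smalloD_tendsto)
  then have "((\<lambda>\<epsilon>. (F \<epsilon> - (L x (y x) Dy + \<epsilon> * G)) / \<epsilon> + G) \<longlongrightarrow> G) (at 0 within S)"
    by simp
  then have "((\<lambda>\<epsilon>. (F \<epsilon> - F 0) / (\<epsilon> - 0)) \<longlongrightarrow> G) (at 0 within S)"
    by (rule Lim_transform_eventually)
      (auto simp: eventually_at_filter F_def V0 diff_divide_distrib add_divide_distrib)
  then have gauge: "(F has_real_derivative G) (at 0 within S)"
    by (simp add: has_field_derivative_iff)

  \<comment> \<open>\<open>c\<close> is the curve of transformed arguments of \<open>L\<close>. Its
    first component stays in [a, b] exactly for parameters in \<open>S\<close>, so the derivative of
    \<open>L\<close> relative to its domain can be composed with \<open>c\<close> within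
    \<open>S\<close>.\<close>
  define c where "c \<epsilon> = ((x + \<epsilon> * \<tau> x (y x), y x + \<epsilon> * \<xi> x (y x)), V \<epsilon>)" for \<epsilon>
  have "(V has_real_derivative V') (at 0)"
    unfolding V_def V'_def p_def using x by (intro transformed_velocity_has_derivative) simp
  then have V_deriv: "(V has_derivative (\<lambda>h. V' * h)) (at 0 within S)"
    unfolding has_field_derivative_def by (rule has_derivative_at_withinI)
  have c_deriv: "(c has_derivative (\<lambda>h. ((h * \<tau> x (y x), h * \<xi> x (y x)), V' * h))) (at 0 within S)"
    unfolding c_def by (auto intro!: derivative_eq_intros V_deriv)
  have c_S: "c ` S \<subseteq> ({a..b} \<times> UNIV) \<times> UNIV"
    by (auto simp: c_def S_def)
  have c0: "c 0 = ((x, y x), Dy)"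
    by (simp add: c_def V0)
  let ?P = "partial_x a b L x (y x) Dy * \<tau> x (y x) + partial_y L x (y x) Dy * \<xi> x (y x)
    + partial_v L x (y x) Dy * V'"
  have "((\<lambda>\<epsilon>. (\<lambda>((x, y), v). L x y v) (c \<epsilon>)) has_derivative (\<lambda>h.
      (\<lambda>((dx, dy), dv). partial_x a b L x (y x) Dy * dx + partial_y L x (y x) Dy * dy
              + partial_v L x (y x) Dy * dv) ((h * \<tau> x (y x), h * \<xi> x (y x)), V' * h)))
      (at 0 within S)"
    by (rule has_derivative_in_compose[OF c_deriv], unfold c0,
        rule has_derivative_subset[OF C1_Lagrangian_has_derivative[OF assms(4) x(2)] c_S])
  then have "((\<lambda>\<epsilon>. L (x + \<epsilon> * \<tau> x (y x)) (y x + \<epsilon> * \<xi> x (y x)) (V \<epsilon>)) has_real_derivative ?P)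
      (at 0 within S)"
    unfolding has_field_derivative_def c_def prod.case
    by (rule has_derivative_eq_rhs) (auto simp: algebra_simps)
  \<comment> \<open>In the product rule the factor \<open>1 + \<epsilon> * (T / p)\<close> has value
    1 and slope \<open>T / p\<close> at 0, which yields the last term of the identity.\<close>
  then have "(F has_real_derivative ?P + L x (y x) Dy * (T / p)) (at 0 within S)"
    unfolding F_def using x by (auto intro!: derivative_eq_intros simp: V0 p_def)
  moreover have "at 0 within S \<noteq> bot"
    unfolding S_def by (rule at_within_shift_preimage_neq_bot[OF assms(1) x(2)])
  ultimately have "?P + L x (y x) Dy * (T / p) = G"
    using gauge
    by (intro vector_derivative_unique_within[of 0 S F])
      (simp_all flip: has_real_derivative_iff_has_vector_derivative)
  then show ?thesis
    by (simp add: Let_def V'_def Dy_def T_def X_def G_def p_def)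
qed

end
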